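(* Let $f_1(x)=\frac12x^\top Q_1x+b_1^\top x$ and $f_2(x)=\frac12x^\top Q_2x+b_2^\top x+c$ on $\mathbb{R}^n$, where $Q_1,Q_2$ are real symmetric $n\times n$ matrices with $\mathrm{Null}(Q_1)\cap\mathrm{Null}(Q_2)=\{0\}$. Assume that $f_1,f_2$ are not both convex, that $f_2(x)<0$ for some $x$, and that $\{\lambda\ge 0: Q_1+\lambda Q_2\succeq 0\}=[\lambda_1,\lambda_2]$ with $\lambda_1<\lambda_2$. Let $h_i(x)=f_1(x)+\lambda_if_2(x)$, $i=1,2$, and $H(x)=\max\{h_1(x),h_2(x)\}$. Assume that $\min_x h_1(x)<\min_x H(x)$ and $\min_x h_2(x)<\min_x H(x)$. Then $H$ has the KL property with exponent $\theta=1/2$; that is, for every $x^*$ with $0\in\partial H(x^* )$ there exist $C,\epsilon>0$ such that $$C\|y\|\ge |H(x)-H(x^* )|^{1/2}\qquad\text{for all }x\text{ with }\|x-x^*\|\le\epsilon\text{ and all }y\in\partial H(x).$$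
   Context: $\|\cdot\|$ is the Euclidean norm; $\partial H$ is the convex subdifferential ($h_1,h_2$ are convex quadratic functions). The minima of $h_1,h_2$ are understood as infima (possibly $-\infty$). KL (Kurdyka–Łojasiewicz) property: a proper lower semicontinuous function $f:\mathbb{R}^n\to\mathbb{R}\cup\{+\infty\}$, continuous on its domain, has the KL property with exponent $\theta\in[0,1)$ if for every $x^*$ with $0\in\partial f(x^* )$ there exist $C,\epsilon>0$ such that $C\|y\|\ge|f(x)-f(x^* )|^\theta$ for all $x$ with $\|x-x^*\|\le\epsilon$ and all $y\in\partial f(x)$. *)

theory Defs
  imports "HOL-Analysis.Analysis"
begin

definition null_space :: "real^'n^'m \<Rightarrow> (real^'n) set" where
  "null_space A = {x. A *v x = 0}"

definition pos_semidef :: "real^'n^'n \<Rightarrow> bool" where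
  "pos_semidef A \<longleftrightarrow> transpose A = A \<and> (\<forall>x. 0 \<le> x \<bullet> (A *v x))"

(* Extended-valued functions model R \<union> {+\<infinity>}; properness excludes the value -\<infinity>. *)

definition dom_fun :: "('a \<Rightarrow> ereal) \<Rightarrow> 'a set" where
  "dom_fun f = {x. f x < \<infinity>}"

definition proper_fun :: "('a \<Rightarrow> ereal) \<Rightarrow> bool" where
  "proper_fun f \<longleftrightarrow> (\<forall>x. f x \<noteq> -\<infinity>) \<and> dom_fun f \<noteq> {}"

definition lsc_fun :: "('a::topological_space \<Rightarrow> ereal) \<Rightarrow> bool" where
  "lsc_fun f \<longleftrightarrow> (\<forall>x. f x \<le> Liminf (at x) f)"

definition subdifferential :: "('a::real_inner \<Rightarrow> ereal) \<Rightarrow> 'a \<Rightarrow> 'a set" where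
  "subdifferential f x = {y. x \<in> dom_fun f \<and> (\<forall>z. f x + ereal (y \<bullet> (z - x)) \<le> f z)}"

(* The coercion real_of_ereal is only ever applied to finite values: f is proper, and a
   nonempty subdifferential forces the point into the domain of f. For \<theta> = 0 the
   convention 0 powr 0 = 0 is the one usual for this property. *)

definition KL_property :: "real \<Rightarrow> ('a::real_inner \<Rightarrow> ereal) \<Rightarrow> bool" where
  "KL_property \<theta> f \<longleftrightarrow>
     0 \<le> \<theta> \<and> \<theta> < 1 \<and> proper_fun f \<and> lsc_fun f \<and> continuous_on (dom_fun f) f \<and>
     (\<forall>xs. 0 \<in> subdifferential f xs \<longrightarrow>
        (\<exists>C>0. \<exists>\<epsilon>>0. \<forall>x. norm (x - xs) \<le> \<epsilon> \<longrightarrow>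
           (\<forall>y\<in>subdifferential f x.
              C * norm y \<ge> \<bar>real_of_ereal (f x) - real_of_ereal (f xs)\<bar> powr \<theta>)))"

end

theory Submission
  imports Defs
begin

text \<open>
  At a minimiser \<open>xs\<close> of \<open>H\<close> both pieces are active and both gradients are nonzero, since otherwise
  one \<open>h\<^sub>i\<close> alone would attain \<open>min H\<close>. As there is no common descent direction, the gradients are
  antiparallel, so some strict convex combination \<open>h\<close> of \<open>h\<^sub>1\<close>, \<open>h\<^sub>2\<close> is stationary at \<open>xs\<close>.
  The null-space condition makes the Hessian of \<open>h\<close> positive definite, and \<open>H \<ge> h\<close> with equality at
  \<open>xs\<close> yields quadratic growth \<open>H x - H xs \<ge> m * norm (x - xs)\<^sup>2\<close>. The subgradient inequality
  \<open>H x - H xs \<le> norm y * norm (x - xs)\<close> then gives exponent \<open>1/2\<close>.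
\<close>

section \<open>Quadratic functions and their exact second-order expansion\<close>

definition quad :: "real^'n^'n \<Rightarrow> real^'n \<Rightarrow> real \<Rightarrow> real^'n \<Rightarrow> real" where
  "quad A b c x = 1/2 * (x \<bullet> (A *v x)) + b \<bullet> x + c"

lemma inner_symmetric_matrix:
  fixes A :: "real^'n^'n"
  assumes "transpose A = A"
  shows "x \<bullet> (A *v y) = (A *v x) \<bullet> y"
  using dot_lmul_matrix[of x A y] transpose_matrix_vector[of A x] assms by simp

lemma quad_add:
  assumes "transpose A = A"
  shows "quad A b c (x + d) = quad A b c x + (A *v x + b) \<bullet> d + 1/2 * (d \<bullet> (A *v d))"
proof -
  have "d \<bullet> (A *v x) = x \<bullet> (A *v d)" "(A *v x) \<bullet> d = x \<bullet> (A *v d)"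
    using inner_symmetric_matrix[OF assms] by (simp_all add: inner_commute)
  then show ?thesis
    by (simp add: quad_def matrix_vector_right_distrib inner_left_distrib inner_right_distrib
        algebra_simps)
qed

lemma continuous_on_quad: "continuous_on S (quad A b c)"
  unfolding quad_def
  by (intro continuous_intros linear_continuous_on linear_linear[THEN iffD1]
      matrix_vector_mul_bounded_linear)

lemma quad_minimum_if_gradient_zero:
  assumes "pos_semidef A" and "A *v x + b = 0"
  shows "quad A b c x \<le> quad A b c z"
  using quad_add[of A b c x "z - x"] assms by (auto simp: pos_semidef_def)

section \<open>Null vectors of semidefinite forms and definiteness of combinations\<close>

lemma pos_semidef_null:
  assumes "pos_semidef A" and "x \<bullet> (A *v x) = 0"
  shows "A *v x = 0"
proof (rule ccontr)
  assume "A *v x \<noteq> 0"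
  define g where "g = A *v x"
  define k where "k = g \<bullet> (A *v g)"
  \<comment> \<open>The step against the gradient \<open>g\<close> changes half the form by
    \<open>- t * (g \<bullet> g) + t * t * k / 2\<close>, which is negative once
    \<open>t * k < 2 * (g \<bullet> g)\<close>. This choice gives even
    \<open>t * k < g \<bullet> g\<close>, and the added 1 keeps the denominator positive when
    \<open>k = 0\<close>.\<close>
  define t where "t = (g \<bullet> g) / (k + 1)"
  have sym: "transpose A = A" and k: "0 \<le> k"
    using assms(1) by (auto simp: pos_semidef_def k_def)
  have g: "0 < g \<bullet> g" using \<open>A *v x \<noteq> 0\<close> by (simp add: g_def)
  have "0 < t" "t * (k + 1) = g \<bullet> g" using g k by (simp_all add: t_def)
  then have t: "0 < t" "t * k + t = g \<bullet> g" by (simp_all add: algebra_simps)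
  have "A *v - (t *\<^sub>R g) = - (t *\<^sub>R (A *v g))"
    by (metis matrix_vector_mult_scaleR scaleR_minus_left)
  moreover have "0 \<le> 1/2 * ((x - t *\<^sub>R g) \<bullet> (A *v (x - t *\<^sub>R g)))"
    using assms(1) by (simp add: pos_semidef_def)
  ultimately have "0 \<le> - t * (g \<bullet> g) + 1/2 * t * (t * k)"
    using quad_add[OF sym, of 0 0 x "- t *\<^sub>R g"] assms(2)
    by (simp add: quad_def g_def[symmetric] k_def inner_commute)
  also have "\<dots> < 0"
  proof -
    have "1/2 * (t * k) < g \<bullet> g" using t g mult_nonneg_nonneg[of t k] k by linarith
    then have "t * (1/2 * (t * k)) < t * (g \<bullet> g)" using t(1) by (rule mult_strict_left_mono)
    then show ?thesis by (simp add: algebra_simps)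
  qed
  finally show False by simp
qed

text \<open>The form attains its minimum on the compact unit sphere, and this positive value serves
  as \<open>m\<close>; homogeneity of degree two carries the bound to all vectors.\<close>

lemma positive_definite_lower_bound:
  fixes A :: "real^'n^'n"
  assumes "\<And>x. x \<noteq> 0 \<Longrightarrow> 0 < x \<bullet> (A *v x)"
  obtains m where "0 < m" and "\<And>x. m * (norm x)\<^sup>2 \<le> x \<bullet> (A *v x)"
proof -
  let ?q = "\<lambda>x. x \<bullet> (A *v x)"
  have "continuous_on (sphere 0 1) ?q"
    \<comment> \<open>Doubling the matrix cancels the factor 1/2 in \<open>quad\<close>.\<close>
    using continuous_on_quad[of "sphere 0 1" "2 *\<^sub>R A" 0 0]
    by (simp add: quad_def scaleR_matrix_vector_assoc[symmetric])
  moreover have "axis undefined 1 \<in> sphere (0::real^'n) 1" by (simp add: norm_axis_1)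
  ultimately obtain e where e: "e \<in> sphere 0 1" "\<And>y. y \<in> sphere 0 1 \<Longrightarrow> ?q e \<le> ?q y"
    using continuous_attains_inf[OF compact_sphere, of 0 1 ?q] by blast
  show thesis
  proof
    show "0 < ?q e" using e(1) by (intro assms) auto
    fix x :: "real^'n"
    show "?q e * (norm x)\<^sup>2 \<le> ?q x"
    proof (cases "x = 0")
      case False
      then have "?q e \<le> ?q (x /\<^sub>R norm x)" by (intro e(2)) simp
      then show ?thesis
        using False by (simp add: matrix_vector_mult_scaleR power2_eq_square field_simps)
    qed simp
  qed
qed

text \<open>Two nonnegative terms with positive weights cancel only if both vanish; by
  \<open>pos_semidef_null\<close> this would put \<open>x\<close> into both null spaces.\<close>

lemma convex_combination_positive_definite:
  fixes A B :: "real^'n^'n"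
  assumes "pos_semidef A" and "pos_semidef B"
    and "null_space A \<inter> null_space B \<subseteq> {0}"
    and "0 < u" and "0 < v" and "x \<noteq> 0"
  shows "0 < x \<bullet> ((u *\<^sub>R A + v *\<^sub>R B) *v x)"
proof -
  have eq: "x \<bullet> ((u *\<^sub>R A + v *\<^sub>R B) *v x) = u * (x \<bullet> (A *v x)) + v * (x \<bullet> (B *v x))"
    by (simp add: matrix_vector_mult_add_rdistrib scaleR_matrix_vector_assoc[symmetric]
        inner_right_distrib)
  have nn: "0 \<le> x \<bullet> (A *v x)" "0 \<le> x \<bullet> (B *v x)"
    using assms(1,2) by (auto simp: pos_semidef_def)
  have "x \<bullet> (A *v x) \<noteq> 0 \<or> x \<bullet> (B *v x) \<noteq> 0"
    using pos_semidef_null[OF assms(1)] pos_semidef_null[OF assms(2)] assms(3,6)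
    by (auto simp: null_space_def)
  then show ?thesis
    unfolding eq using nn assms(4,5)
    by (metis add_nonneg_pos add_pos_nonneg mult_nonneg_nonneg mult_pos_pos less_eq_real_def)
qed

section \<open>Descent directions and quadratic growth of the maximum\<close>

lemma quad_eventually_less:
  assumes "transpose A = A" and "quad A b c x \<le> M"
    and "quad A b c x = M \<Longrightarrow> (A *v x + b) \<bullet> d < 0"
  shows "\<forall>\<^sub>F t in at_right 0. quad A b c (x + t *\<^sub>R d) < M"
proof -
  \<comment> \<open>\<open>s t\<close> is the difference quotient along \<open>d\<close>, with the
    directional derivative as its limit. An active piece drops because \<open>s t\<close> becomes
    negative; an inactive one stays below \<open>M\<close> by continuity, whatever \<open>d\<close>
    is.\<close>
  define s where "s t = (A *v x + b) \<bullet> d + 1/2 * t * (d \<bullet> (A *v d))" for t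
  have expand: "quad A b c (x + t *\<^sub>R d) = quad A b c x + t * s t" for t
    using quad_add[OF assms(1), of b c x "t *\<^sub>R d"]
    by (simp add: s_def matrix_vector_mult_scaleR algebra_simps)
  have s: "(s \<longlongrightarrow> (A *v x + b) \<bullet> d) (at_right 0)"
    unfolding s_def by (auto intro!: tendsto_eq_intros)
  show ?thesis
  proof (cases "quad A b c x = M")
    case True
    have "\<forall>\<^sub>F t in at_right 0. s t < 0" using order_tendstoD(2)[OF s] assms(3) True by simp
    then show ?thesis
      using eventually_at_right_less[of 0]
      by eventually_elim (simp add: expand True mult_pos_neg)
  next
    case False
    have "((\<lambda>t. quad A b c x + t * s t) \<longlongrightarrow> quad A b c x) (at_right 0)"
      by (rule tendsto_eq_intros s refl | simp)+
    then show ?thesis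
      unfolding expand using assms(2) False by (intro order_tendstoD(2)) auto
  qed
qed

text \<open>This is the equality case of Cauchy-Schwarz for the pair \<open>g\<close> and
  \<open>- g'\<close>.\<close>

lemma inner_eq_neg_norms_iff_antiparallel:
  fixes g g' :: "'a::real_inner"
  shows "g \<bullet> g' = - (norm g * norm g') \<longleftrightarrow> norm g' *\<^sub>R g + norm g *\<^sub>R g' = 0"
proof -
  have "g \<bullet> g' = - (norm g * norm g') \<longleftrightarrow> g \<bullet> (- g') = norm g * norm (- g')" by auto
  also have "\<dots> \<longleftrightarrow> norm g *\<^sub>R (- g') = norm g' *\<^sub>R g"
    by (subst norm_cauchy_schwarz_eq) simp
  also have "\<dots> \<longleftrightarrow> norm g' *\<^sub>R g + norm g *\<^sub>R g' = 0"
    by (metis add.commute add_eq_0_iff scaleR_minus_right)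
  finally show ?thesis .
qed

lemma max_quad_growth:
  fixes A A' :: "real^'n^'n"
  assumes psd: "pos_semidef A" "pos_semidef A'"
    and null: "null_space A \<inter> null_space A' \<subseteq> {0}"
    and min: "\<And>z. max (quad A b c xs) (quad A' b' c' xs) \<le> max (quad A b c z) (quad A' b' c' z)"
    and below: "\<exists>z. quad A b c z < max (quad A b c xs) (quad A' b' c' xs)"
      "\<exists>z. quad A' b' c' z < max (quad A b c xs) (quad A' b' c' xs)"
  obtains m where "0 < m"
    and "\<And>z. max (quad A b c xs) (quad A' b' c' xs) + m * (norm (z - xs))\<^sup>2
      \<le> max (quad A b c z) (quad A' b' c' z)"
proof -
  let ?h = "quad A b c" and ?h' = "quad A' b' c'"
  define M where "M = max (?h xs) (?h' xs)"
  define g where "g = A *v xs + b"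
  define g' where "g' = A' *v xs + b'"
  have sym: "transpose A = A" "transpose A' = A'" using psd by (auto simp: pos_semidef_def)
  have le: "?h xs \<le> M" "?h' xs \<le> M" by (auto simp: M_def)
  \<comment> \<open>Only active pieces need a negative slope. Working with eventual statements at 0
    lets both pieces share one step length \<open>t\<close>, which contradicts minimality.\<close>
  have no_descent: False
    if "?h xs = M \<Longrightarrow> g \<bullet> d < 0" and "?h' xs = M \<Longrightarrow> g' \<bullet> d < 0" for d
  proof -
    have "\<forall>\<^sub>F t in at_right 0. ?h (xs + t *\<^sub>R d) < M \<and> ?h' (xs + t *\<^sub>R d) < M"
      using that by (intro eventually_conj quad_eventually_less sym le) (auto simp: g_def g'_def)
    then obtain t where "?h (xs + t *\<^sub>R d) < M" "?h' (xs + t *\<^sub>R d) < M"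
      using eventually_happens'[OF trivial_limit_at_right_real] by blast
    then show False using min[of "xs + t *\<^sub>R d"] unfolding M_def by linarith
  qed
  have g_nz: "g \<noteq> 0" if "?h xs = M"
    using quad_minimum_if_gradient_zero[OF psd(1), of xs b c] below(1) that
    unfolding g_def M_def by (metis not_less)
  have g'_nz: "g' \<noteq> 0" if "?h' xs = M"
    using quad_minimum_if_gradient_zero[OF psd(2), of xs b' c'] below(2) that
    unfolding g'_def M_def by (metis not_less)
  have some_active: "?h xs = M \<or> ?h' xs = M" by (auto simp: M_def)
  have active: "?h xs = M" "?h' xs = M"
  proof -
    show "?h xs = M"
    proof (rule ccontr)
      assume "?h xs \<noteq> M"
      \<comment> \<open>With the first piece inactive only the second slope matters, and along
        \<open>- g'\<close> it is \<open>- (g' \<bullet> g') < 0\<close>.\<close>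
      then show False using some_active g'_nz by (intro no_descent[of "- g'"]) auto
    qed
    show "?h' xs = M"
    proof (rule ccontr)
      assume "?h' xs \<noteq> M"
      then show False using some_active g_nz by (intro no_descent[of "- g"]) auto
    qed
  qed
  define n where "n = norm g"
  define n' where "n' = norm g'"
  have n: "0 < n" "0 < n'" using g_nz g'_nz active by (auto simp: n_def n'_def)
  have "g \<bullet> g' = - (n * n')"
  proof (rule ccontr)
    assume "g \<bullet> g' \<noteq> - (n * n')"
    then have lt: "0 < n * n' + g \<bullet> g'"
      using Cauchy_Schwarz_ineq2[of g g'] by (auto simp: n_def n'_def)
    \<comment> \<open>The descent direction is the negative bisector of the gradients:
      \<open>n' *\<^sub>R g\<close> and \<open>n *\<^sub>R g'\<close> have the same length
      \<open>n * n'\<close>, so both slopes are negative multiples of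
      \<open>n * n' + g \<bullet> g'\<close>.\<close>
    show False
    proof (rule no_descent)
      have "g \<bullet> - (n' *\<^sub>R g + n *\<^sub>R g') = - (n * (n * n' + g \<bullet> g'))"
        by (simp add: inner_right_distrib inner_diff_right n_def power2_norm_eq_inner[symmetric]
            power2_eq_square algebra_simps)
      then show "g \<bullet> - (n' *\<^sub>R g + n *\<^sub>R g') < 0" using n lt by simp
      have "g' \<bullet> - (n' *\<^sub>R g + n *\<^sub>R g') = - (n' * (n * n' + g \<bullet> g'))"
        by (simp add: inner_right_distrib inner_diff_right n'_def power2_norm_eq_inner[symmetric]
            power2_eq_square inner_commute[of g' g] algebra_simps)
      then show "g' \<bullet> - (n' *\<^sub>R g + n *\<^sub>R g') < 0" using n lt by simp
    qed
  qed
  then have stat: "n' *\<^sub>R g + n *\<^sub>R g' = 0"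
    by (simp add: n_def n'_def inner_eq_neg_norms_iff_antiparallel)
  \<comment> \<open>Dividing the relation \<open>stat\<close> by \<open>n + n'\<close> turns its
    coefficients into weights of a convex combination.\<close>
  define u where "u = n' / (n + n')"
  define v where "v = n / (n + n')"
  have uv: "0 < u" "0 < v" "u + v = 1" using n by (simp_all add: u_def v_def add_divide_distrib[symmetric])
  have stat': "u *\<^sub>R g + v *\<^sub>R g' = 0"
  proof -
    have "u *\<^sub>R g + v *\<^sub>R g' = (1 / (n + n')) *\<^sub>R (n' *\<^sub>R g + n *\<^sub>R g')"
      by (simp add: u_def v_def scaleR_add_right)
    then show ?thesis by (simp add: stat)
  qed
  define B where "B = u *\<^sub>R A + v *\<^sub>R A'"
  obtain m where m: "0 < m" "\<And>x. m * (norm x)\<^sup>2 \<le> x \<bullet> (B *v x)"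
    unfolding B_def
    using positive_definite_lower_bound convex_combination_positive_definite[OF psd null uv(1,2)]
    by metis
  show thesis
  proof
    show "0 < m / 2" using m by simp
    fix z
    define d where "d = z - xs"
    have hz: "?h z = M + g \<bullet> d + 1/2 * (d \<bullet> (A *v d))"
      "?h' z = M + g' \<bullet> d + 1/2 * (d \<bullet> (A' *v d))"
      using quad_add[OF sym(1), of b c xs d] quad_add[OF sym(2), of b' c' xs d] active
      by (auto simp: d_def g_def g'_def)
    \<comment> \<open>The combination of the two pieces is expanded at \<open>xs\<close>: its linear
      term vanishes by \<open>stat'\<close>, and its value there is \<open>M\<close> because both
      pieces are active.\<close>
    have "M + m / 2 * (norm d)\<^sup>2 \<le> M + 1/2 * (d \<bullet> (B *v d))" using m(2)[of d] by simp
    also have "\<dots> = (u + v) * M + (u *\<^sub>R g + v *\<^sub>R g') \<bullet> d + 1/2 * (d \<bullet> (B *v d))"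
      by (simp add: stat' uv(3))
    also have "\<dots> = u * ?h z + v * ?h' z"
      unfolding hz B_def
      by (simp add: matrix_vector_mult_add_rdistrib scaleR_matrix_vector_assoc[symmetric]
          inner_left_distrib inner_right_distrib algebra_simps)
    also have "\<dots> \<le> max (?h z) (?h' z)"
      using uv by (intro convex_bound_le) auto
    finally show "max (?h xs) (?h' xs) + m / 2 * (norm (z - xs))\<^sup>2 \<le> max (?h z) (?h' z)"
      by (simp add: M_def d_def)
  qed
qed

section \<open>From quadratic growth at minimisers to the KL exponent 1/2\<close>

lemma KL_property_half_if_quadratic_growth:
  fixes f :: "'a::real_inner \<Rightarrow> real"
  assumes cont: "continuous_on UNIV f"
    and growth: "\<And>xs. (\<And>z. f xs \<le> f z) \<Longrightarrow> \<exists>m>0. \<forall>z. f xs + m * (norm (z - xs))\<^sup>2 \<le> f z"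
  shows "KL_property (1/2) (\<lambda>x. ereal (f x))"
proof -
  have dom: "dom_fun (\<lambda>x. ereal (f x)) = UNIV" by (simp add: dom_fun_def)
  have contE: "continuous_on UNIV (\<lambda>x. ereal (f x))" using cont by (intro continuous_intros)
  have lsc: "lsc_fun (\<lambda>x. ereal (f x))"
    unfolding lsc_fun_def
  proof
    fix x
    have lim: "((\<lambda>x. ereal (f x)) \<longlongrightarrow> ereal (f x)) (at x)"
      using contE unfolding continuous_on_def by blast
    show "ereal (f x) \<le> Liminf (at x) (\<lambda>x. ereal (f x))"
    proof (cases "at x = bot")
      \<comment> \<open>In a one-point space \<open>at x\<close> is the trivial filter; the
        predicate that is always false is then eventual, and the infimum over the empty set is
        infinite.\<close>
      case True
      then show ?thesis
        unfolding Liminf_def by (intro SUP_upper2[of "\<lambda>_. False"]) auto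
    next
      case False
      then show ?thesis using lim_imp_Liminf[OF _ lim] by simp
    qed
  qed
  have "\<exists>C>0. \<exists>\<epsilon>>0. \<forall>x. norm (x - xs) \<le> \<epsilon> \<longrightarrow>
      (\<forall>y\<in>subdifferential (\<lambda>x. ereal (f x)) x. \<bar>f x - f xs\<bar> powr (1/2) \<le> C * norm y)"
    if xs: "0 \<in> subdifferential (\<lambda>x. ereal (f x)) xs" for xs
  proof -
    have min: "f xs \<le> f z" for z using xs by (simp add: subdifferential_def)
    then obtain m where m: "0 < m" "\<And>z. f xs + m * (norm (z - xs))\<^sup>2 \<le> f z"
      using growth by blast
    have "sqrt (f x - f xs) \<le> 1 / sqrt m * norm y"
      if y: "y \<in> subdifferential (\<lambda>x. ereal (f x)) x" for x y
    proof -
      define r where "r = f x - f xs"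
      define s where "s = norm (x - xs)"
      have r: "0 \<le> r" "m * s\<^sup>2 \<le> r" using min[of x] m(2)[of x] by (auto simp: r_def s_def)
      have "f x + y \<bullet> (xs - x) \<le> f xs" using y by (simp add: subdifferential_def)
      then have "r \<le> y \<bullet> (x - xs)" by (simp add: r_def inner_diff_right)
      also have "\<dots> \<le> norm y * s" unfolding s_def by (rule norm_cauchy_schwarz)
      finally have le: "r \<le> norm y * s" .
      \<comment> \<open>Squaring \<open>r \<le> norm y * s\<close> and replacing
        \<open>m * s\<^sup>2\<close> by its upper bound \<open>r\<close> leaves one surplus factor
        \<open>r\<close> on each side, which cancels unless \<open>r = 0\<close>.\<close>
      have "m * r \<le> (norm y)\<^sup>2"
      proof (cases "r = 0")
        case False
        have "r * (m * r) = m * r\<^sup>2" by (simp add: power2_eq_square)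
        also have "\<dots> \<le> m * (norm y * s)\<^sup>2" using le r m(1) by (intro mult_left_mono power_mono) auto
        also have "\<dots> = (norm y)\<^sup>2 * (m * s\<^sup>2)" by (simp add: power_mult_distrib)
        also have "\<dots> \<le> (norm y)\<^sup>2 * r" using r by (intro mult_left_mono) auto
        finally show ?thesis using False r by (simp add: mult.commute)
      qed simp
      then have "sqrt m * sqrt r \<le> norm y"
        by (metis norm_ge_zero real_sqrt_le_mono real_sqrt_mult real_sqrt_unique)
      then show ?thesis using m(1) by (simp add: r_def field_simps)
    qed
    then show ?thesis
      \<comment> \<open>The growth bound is global, so the radius 1 is an arbitrary choice.\<close>
      using min m(1) by (intro exI[of _ "1 / sqrt m"] exI[of _ "1::real"] conjI) (simp_all add: powr_half_sqrt)
  qed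
  then show ?thesis
    using contE lsc by (simp add: KL_property_def proper_fun_def dom)
qed

theorem theorem3p4:
  fixes Q1 Q2 :: "real^'n^'n" and b1 b2 :: "real^'n" and c l1 l2 :: real
    and f1 f2 h1 h2 H :: "real^'n \<Rightarrow> real"
  assumes "transpose Q1 = Q1" and "transpose Q2 = Q2"
    and "null_space Q1 \<inter> null_space Q2 = {0}"
    and "\<And>x. f1 x = 1/2 * (x \<bullet> (Q1 *v x)) + b1 \<bullet> x"
    and "\<And>x. f2 x = 1/2 * (x \<bullet> (Q2 *v x)) + b2 \<bullet> x + c"
    and "\<not> (convex_on UNIV f1 \<and> convex_on UNIV f2)"
    and "\<exists>x. f2 x < 0"
    and "{l. 0 \<le> l \<and> pos_semidef (Q1 + l *\<^sub>R Q2)} = {l1..l2}"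
    and "l1 < l2"
    and "\<And>x. h1 x = f1 x + l1 * f2 x"
    and "\<And>x. h2 x = f1 x + l2 * f2 x"
    and "\<And>x. H x = max (h1 x) (h2 x)"
    and "(INF x. ereal (h1 x)) < (INF x. ereal (H x))"
    and "(INF x. ereal (h2 x)) < (INF x. ereal (H x))"
  shows "KL_property (1/2) (\<lambda>x. ereal (H x))"
proof (rule KL_property_half_if_quadratic_growth)
  define A where "A l = Q1 + l *\<^sub>R Q2" for l
  \<comment> \<open>Both \<open>h1\<close> and \<open>h2\<close> are members of this family, at the
    two ends of the interval of multipliers.\<close>
  define q where "q l = quad (A l) (b1 + l *\<^sub>R b2) (l * c)" for l
  have q: "f1 x + l * f2 x = q l x" for l x
    by (simp add: assms(4,5) q_def quad_def A_def matrix_vector_mult_add_rdistrib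
        scaleR_matrix_vector_assoc[symmetric] inner_left_distrib inner_right_distrib algebra_simps)
  have h: "h1 = q l1" "h2 = q l2" by (simp_all add: fun_eq_iff assms(10,11) q)
  have H: "H = (\<lambda>x. max (q l1 x) (q l2 x))" by (simp add: fun_eq_iff assms(12) h)
  have psd: "pos_semidef (A l1)" "pos_semidef (A l2)"
  proof -
    have "l1 \<in> {l1..l2}" "l2 \<in> {l1..l2}" using assms(9) by auto
    then show "pos_semidef (A l1)" "pos_semidef (A l2)"
      unfolding assms(8)[symmetric] A_def by auto
  qed
  \<comment> \<open>\<open>A l1\<close> and \<open>A l2\<close> differ by a nonzero multiple of
    \<open>Q2\<close>, so a common null vector is annihilated by \<open>Q2\<close> and hence also by
    \<open>Q1\<close>.\<close>
  have null: "null_space (A l1) \<inter> null_space (A l2) \<subseteq> {0}"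
  proof
    fix x assume "x \<in> null_space (A l1) \<inter> null_space (A l2)"
    then have eqs: "Q1 *v x + l1 *\<^sub>R (Q2 *v x) = 0" "Q1 *v x + l2 *\<^sub>R (Q2 *v x) = 0"
      by (auto simp: null_space_def A_def matrix_vector_mult_add_rdistrib
          scaleR_matrix_vector_assoc[symmetric])
    then have "l1 *\<^sub>R (Q2 *v x) = l2 *\<^sub>R (Q2 *v x)" by (metis add_left_imp_eq)
    then have "Q2 *v x = 0" using assms(9) by simp
    then have "x \<in> null_space Q1 \<inter> null_space Q2" using eqs by (simp add: null_space_def)
    then show "x \<in> {0}" using assms(3) by simp
  qed
  show "continuous_on UNIV H"
    unfolding H q_def by (intro continuous_on_max continuous_on_quad)
  fix xs assume min: "\<And>z. H xs \<le> H z"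
  \<comment> \<open>The gap between the infima becomes a concrete point below \<open>H xs\<close>;
    comparing in the extended reals covers an infimum of minus infinity as well.\<close>
  have below: "\<exists>z. h z < H xs" if "(INF x. ereal (h x)) < (INF x. ereal (H x))" for h
  proof -
    have "(INF x. ereal (h x)) < ereal (H xs)"
      using that INF_lower[of xs UNIV "\<lambda>x. ereal (H x)"] by (auto intro: less_le_trans)
    then show ?thesis by (auto simp: INF_less_iff)
  qed
  show "\<exists>m>0. \<forall>z. H xs + m * (norm (z - xs))\<^sup>2 \<le> H z"
    using max_quad_growth[OF psd null, of "b1 + l1 *\<^sub>R b2" "l1 * c" xs "b1 + l2 *\<^sub>R b2" "l2 * c"]
      min below[OF assms(13)] below[OF assms(14)]
    unfolding h H q_def by metis
qed

end
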